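(* The projection $D_{\mathcal P}\to\mathcal D_{\mathcal P,0}$, $(k_1,k_2,q_1,q_2,q_3,q_4,m_1,m_2)\mapsto(k_1,k_2,q_1,q_2)$, is a bijection, where $D_{\mathcal P}\subset\mathbb Z^8$ and $\mathcal D_{\mathcal P,0}\subset\mathbb Z^4$ are the sets defined in the context.
   Context: $\mathcal D_{\mathcal P,0}$ is the set of $(k_1,k_2,q_1,q_2)\in\mathbb Z^4$ with $k_1k_2-k_1q_2-k_2q_1=1$, $0\le q_1<k_1$, $0\le q_2<k_2$ and $\min(k_1,k_2)\ge2$. $D_{\mathcal P}$ is the set of $(k_1,k_2,q_1,q_2,q_3,q_4,m_1,m_2)\in\mathbb Z^8$ satisfying the inequalities $\min(k_1,k_2)\ge2$, $m_1\ge0$, $m_2\ge0$, $0<q_1<k_1$, $0<q_2<k_2$, $0<q_3<k_1+k_2$, $0<q_4<k_1k_2$ and the equations $$k_1k_2-k_1q_2-k_2q_1=1,$$ $$k_1k_2(k_1+k_2)-k_1k_2q_3-q_4(k_1+k_2)=1,$$ $$q_4=k_1m_1+q_1=k_2m_2+q_2.$$ *)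

theory Defs
  imports Main
begin

definition D_P0 :: "(int \<times> int \<times> int \<times> int) set" where
  "D_P0 = {(k1, k2, q1, q2).
     k1 * k2 - k1 * q2 - k2 * q1 = 1 \<and>
     0 \<le> q1 \<and> q1 < k1 \<and> 0 \<le> q2 \<and> q2 < k2 \<and> min k1 k2 \<ge> 2}"

definition D_P :: "(int \<times> int \<times> int \<times> int \<times> int \<times> int \<times> int \<times> int) set" where
  "D_P = {(k1, k2, q1, q2, q3, q4, m1, m2).
     min k1 k2 \<ge> 2 \<and> m1 \<ge> 0 \<and> m2 \<ge> 0 \<and>
     0 < q1 \<and> q1 < k1 \<and> 0 < q2 \<and> q2 < k2 \<and>
     0 < q3 \<and> q3 < k1 + k2 \<and> 0 < q4 \<and> q4 < k1 * k2 \<and>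
     k1 * k2 - k1 * q2 - k2 * q1 = 1 \<and>
     k1 * k2 * (k1 + k2) - k1 * k2 * q3 - q4 * (k1 + k2) = 1 \<and>
     q4 = k1 * m1 + q1 \<and> k1 * m1 + q1 = k2 * m2 + q2}"

end

theory Submission
  imports Defs
begin

text \<open>
  Modulo \<open>k1 k2\<close> the second equation reads \<open>q4 (k1 + k2) = -1\<close>, and \<open>k1 + k2\<close> is invertible there,
  so \<open>q4\<close> and then \<open>q3\<close>, \<open>m1\<close>, \<open>m2\<close> are determined. Conversely \<open>k1 q2 + k2 q1 = k1 k2 - 1\<close> makes
  \<open>-k2 q1\<close> and \<open>-k1 q2\<close> the idempotents of the Chinese remainder theorem, so the residue of
  \<open>-(k2 q1\<^sup>2 + k1 q2\<^sup>2)\<close> is congruent to \<open>q1\<close> modulo \<open>k1\<close> and to \<open>q2\<close> modulo \<open>k2\<close>; it solves the equation.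
\<close>

lemma eq_if_dvd_diff_bounded:
  fixes x y n :: int
  assumes "n dvd x - y" "0 \<le> x" "x < n" "0 \<le> y" "y < n"
  shows "x = y"
  using assms by (metis mod_eq_dvd_iff mod_pos_pos_trivial)

text \<open>Either equation is a Bezout identity for \<open>n\<close> and \<open>s\<close>, so they
  are coprime; the difference of the two shows that \<open>n\<close> divides
  \<open>(x - y) * s\<close>.\<close>

lemma q4_unique:
  fixes n s x y u v :: int
  assumes "n * s - n * u - x * s = 1" "n * s - n * v - y * s = 1"
    and "0 < x" "x < n" "0 < y" "y < n"
  shows "x = y" and "u = v"
proof -
  have diff: "(x - y) * s = n * (v - u)"
    using assms(1,2) by (simp add: algebra_simps)
  hence dvd: "n dvd (x - y) * s" by simp
  have "(s - u) * n + (- x) * s = 1"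
    using assms(1) by (simp add: algebra_simps)
  hence "coprime n s"
    by (metis coprimeI dvd_add dvd_mult)
  with dvd have "n dvd x - y"
    by (simp add: coprime_dvd_mult_left_iff)
  thus "x = y"
    using assms by (intro eq_if_dvd_diff_bounded[of n]) auto
  with diff have "n * (v - u) = 0" by simp
  thus "u = v" using assms(3,4) by simp
qed

text \<open>\<open>a * (m + 1)\<close> equals \<open>r + (a - q)\<close>, which is positive.\<close>

lemma quotient_nonneg:
  fixes a m q r :: int
  assumes "r = a * m + q" "0 \<le> r" "0 < a" "q < a"
  shows "0 \<le> m"
proof -
  have "0 < a * (m + 1)" using assms by (simp add: algebra_simps)
  thus ?thesis using \<open>0 < a\<close> by (simp add: zero_less_mult_iff)
qed

lemma D_P_fibre_nonempty:
  fixes a b q1 q2 :: int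
  assumes eq: "a * b - a * q2 - b * q1 = 1"
    and a: "2 \<le> a" and b: "2 \<le> b"
    and "0 \<le> q1" "q1 < a" "0 \<le> q2" "q2 < b"
  shows "\<exists>q3 q4 m1 m2. (a, b, q1, q2, q3, q4, m1, m2) \<in> D_P"
proof -
  \<comment> \<open>\<open>D_P\<close> has strict lower bounds: \<open>q1 = 0\<close> or
    \<open>q2 = 0\<close> would make \<open>a\<close> or \<open>b\<close> a divisor of 1.\<close>
  have q1: "q1 \<noteq> 0"
  proof
    assume "q1 = 0"
    hence "a * (b - q2) = 1" using eq by (simp add: algebra_simps)
    thus False using a by (simp add: zmult_eq_1_iff)
  qed
  have q2: "q2 \<noteq> 0"
  proof
    assume "q2 = 0"
    hence "b * (a - q1) = 1" using eq by (simp add: algebra_simps)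
    thus False using b by (simp add: zmult_eq_1_iff)
  qed
  have "2 * 2 \<le> a * b" using a b by (intro mult_mono) auto
  hence n: "4 \<le> a * b" by simp
  define z where "z = - (b * q1 * q1 + a * q2 * q2)"
  define r where "r = z mod (a * b)"
  define t where "t = z div (a * b)"
  have r: "r = z - a * b * t" by (simp add: r_def t_def minus_mult_div_eq_mod)
  have r_bounds: "0 \<le> r" "r < a * b" using n by (simp_all add: r_def)
  \<comment> \<open>\<open>w\<close> stands for \<open>a + b - q3\<close>; its last term accounts
    for reducing \<open>z\<close> to \<open>r\<close>.\<close>
  define w where "w = 2 - a * b - (q1 - q2) * (q1 - q2) - t * (a + b)"
  have b1: "b * q1 = a * b - a * q2 - 1" using eq by simp
  \<comment> \<open>The squares of \<open>b * q1\<close> and \<open>a * q2\<close> are completed to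
    the square of their sum \<open>a * b - 1\<close>, which leaves -1 modulo
    \<open>a * b\<close>.\<close>
  have "z * (a + b) = a * b * (2 - a * b - (q1 - q2) * (q1 - q2)) - 1"
    unfolding z_def using b1 by algebra
  hence rw: "r * (a + b) = a * b * w - 1"
    unfolding r w_def by (simp add: algebra_simps)
  have "r \<noteq> 0"
  proof
    assume "r = 0"
    hence "a * b * w = 1" using rw by simp
    thus False using n by (auto simp: zmult_eq_1_iff)
  qed
  with r_bounds have r_pos: "0 < r" by simp
  have "0 < r * (a + b)" using r_pos a b by simp
  hence "0 < a * b * w" using rw by linarith
  hence w_pos: "0 < w" using n by (simp add: zero_less_mult_iff)
  have "r * (a + b) \<le> (a * b - 1) * (a + b)"
    using r_bounds a b by (intro mult_right_mono) auto
  hence "a * b * w < a * b * (a + b)"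
    using rw a b by (simp add: algebra_simps)
  hence w_less: "w < a + b" using n by (simp add: mult_less_cancel_left)
  \<comment> \<open>Replacing one factor \<open>b * q1\<close> of \<open>b * q1 * q1\<close> by
    \<open>a * (b - q2) - 1\<close> splits \<open>r\<close> into \<open>q1\<close> and a multiple of
    \<open>a\<close>; \<open>m2\<close> is symmetric.\<close>
  define m1 where "m1 = - (q1 * (b - q2) + q2 * q2 + b * t)"
  define m2 where "m2 = - (q2 * (a - q1) + q1 * q1 + a * t)"
  have m1: "r = a * m1 + q1" unfolding r z_def m1_def using b1 by algebra
  have m2: "r = b * m2 + q2" unfolding r z_def m2_def using b1 by algebra
  have "0 \<le> m1" "0 \<le> m2"
    using quotient_nonneg[OF m1] quotient_nonneg[OF m2] r_bounds assms by auto
  moreover have "a * b * (a + b) - a * b * (a + b - w) - r * (a + b) = 1"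
    using rw by (simp add: algebra_simps)
  ultimately have "(a, b, q1, q2, a + b - w, r, m1, m2) \<in> D_P"
    using assms q1 q2 r_pos r_bounds w_pos w_less m1 m2 by (simp add: D_P_def)
  thus ?thesis by blast
qed

theorem theorem3:
  shows "bij_betw (\<lambda>(k1, k2, q1, q2, q3, q4, m1, m2). (k1, k2, q1, q2)) D_P D_P0"
    (is "bij_betw ?\<pi> _ _")
proof (rule bij_betw_imageI)
  show "inj_on ?\<pi> D_P"
  proof (rule inj_onI, clarsimp)
    fix a b q1 q2 q3 q4 m1 m2 q3' q4' m1' m2'
    assume 1: "(a, b, q1, q2, q3, q4, m1, m2) \<in> D_P"
      and 2: "(a, b, q1, q2, q3', q4', m1', m2') \<in> D_P"
    have "q4 = q4'" "q3 = q3'"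
      using q4_unique[of "a * b" "a + b" q3 q4 q3' q4'] 1 2 by (auto simp: D_P_def)
    moreover from this have "a * m1 = a * m1'" "b * m2 = b * m2'" "a \<noteq> 0" "b \<noteq> 0"
      using 1 2 unfolding D_P_def mem_Collect_eq prod.case by linarith+
    ultimately show "q3 = q3' \<and> q4 = q4' \<and> m1 = m1' \<and> m2 = m2'" by simp
  qed
  show "?\<pi> ` D_P = D_P0"
  proof
    show "?\<pi> ` D_P \<subseteq> D_P0" by (auto simp: D_P_def D_P0_def)
    show "D_P0 \<subseteq> ?\<pi> ` D_P"
    proof clarify
      fix a b q1 q2
      assume "(a, b, q1, q2) \<in> D_P0"
      then obtain q3 q4 m1 m2 where "(a, b, q1, q2, q3, q4, m1, m2) \<in> D_P"
        \<comment> \<open>The equation mentions \<open>q2\<close> before \<open>q1\<close>, hence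
          this order; their roles are not exchanged.\<close>
        using D_P_fibre_nonempty[of a b q2 q1] by (auto simp: D_P0_def)
      thus "(a, b, q1, q2) \<in> ?\<pi> ` D_P" by force
    qed
  qed
qed

end
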